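(* There exist a strictly increasing infinite sequence of positive integers $n_1<n_2<n_3<\cdots$ and, for each $i$, a constant-weight Gray code $G_i$ for $(1,2,n_i)$-LRM with weight $w=3$, such that $\mathrm{Eff}(G_i)=1-o(1)$, i.e. $\mathrm{Eff}(G_i)\to 1$ as $i\to\infty$.
   Context: Write a binary string of length $n$ as $v=v_0v_1\cdots v_{n-1}$ with indices taken modulo $n$. Let $S(n,w)$ be the set of binary strings of length $n$ with exactly $w$ ones (weight $w$), where $1\le w\le n-1$. For $0\le j\le n-1$, the string $v'=\tau_j(v)$ is given by $v'_j=0$, $v'_{j+1}=1$ (index mod $n$), and $v'_k=v_k$ for all other $k$. A constant-weight Gray code of weight $w$ and size $N$ for $(1,2,n)$-LRM ("local rank modulation") is a sequence $G=g_0,\dots,g_{N-1}$ of distinct strings in $S(n,w)$ such that for every $0\le i\le N-2$ there is a $j$ with $g_{i+1}=\tau_j(g_i)$. The efficiency of $G$ is $\mathrm{Eff}(G)=N/\binom{n}{w}$. *)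

theory Defs
  imports Complex_Main
begin

text \<open>A binary string is a \<open>bool list\<close>, with \<open>True\<close> for the digit 1; positions are \<open>0, \<dots>, n - 1\<close>.\<close>

definition weight :: "bool list \<Rightarrow> nat" where
  "weight v = card {k. k < length v \<and> v ! k}"

definition const_weight_strings :: "nat \<Rightarrow> nat \<Rightarrow> bool list set" where
  "const_weight_strings n w = {v. length v = n \<and> weight v = w}"

text \<open>The transition is defined on all strings, whatever their entries at \<open>j\<close> and \<open>j + 1\<close>. It preserves
  the weight only if these entries are 1,0 or 0,1; the other cases are excluded from Gray codes by
  the requirement that all codewords have the same weight.\<close>

definition \<tau> :: "nat \<Rightarrow> bool list \<Rightarrow> bool list" where
  "\<tau> j v = v[j := False, (j + 1) mod length v := True]"

definition const_weight_gray_code :: "nat \<Rightarrow> nat \<Rightarrow> bool list list \<Rightarrow> bool" where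
  "const_weight_gray_code n w G \<longleftrightarrow>
     1 \<le> w \<and> w \<le> n - 1 \<and>
     set G \<subseteq> const_weight_strings n w \<and>
     distinct G \<and>
     (\<forall>i. i + 1 < length G \<longrightarrow> (\<exists>j<n. G ! (i + 1) = \<tau> j (G ! i)))"

definition efficiency :: "nat \<Rightarrow> nat \<Rightarrow> bool list list \<Rightarrow> real" where
  "efficiency n w G = real (length G) / real (n choose w)"

end

theory Submission
  imports Defs "HOL-Number_Theory.Cong" "HOL-Library.Infinite_Set"
begin

text \<open>
  Regard the ones of a codeword as three particles on a cycle of prime length \<open>n \<ge> 5\<close>; a transition
  moves one particle one step forward. The codewords with smallest gap \<open>k\<close> are the sets
  \<open>{b - k, b, b + k + r}\<close> with \<open>0 \<le> r < n - 3k\<close>. Moving the third particle \<open>n - 3k\<close> times turns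
  \<open>{b - k, b, b + k}\<close> into its translate by \<open>-k\<close>. As \<open>k\<close> is invertible modulo \<open>n\<close>, \<open>n\<close> repetitions
  of this round run through all codewords with smallest gap \<open>k\<close>, and from the last of them one
  transition leads to the first set of the same form for \<open>k + 1\<close>. For prime \<open>n\<close> this Gray
  code exhausts all strings of weight 3, so its efficiency is exactly 1.
\<close>

section \<open>Strings as sets of residues\<close>

text \<open>Positions are unreduced integers, possibly negative, so particles can travel around the
  cycle without index reduction.\<close>

definition word :: "nat \<Rightarrow> int set \<Rightarrow> bool list" where
  "word n A = map (\<lambda>i. \<exists>x\<in>A. [x = int i] (mod int n)) [0..<n]"

lemma length_word [simp]: "length (word n A) = n"
  by (simp add: word_def)

lemma nth_word: "i < n \<Longrightarrow> word n A ! i \<longleftrightarrow> (\<exists>x\<in>A. [x = int i] (mod int n))"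
  by (simp add: word_def)

lemma cong_int_iff_nat_mod:
  assumes "i < n"
  shows "[x = int i] (mod int n) \<longleftrightarrow> i = nat (x mod int n)"
  using assms by (auto simp: cong_def)

lemma weight_word:
  assumes "0 < n" "pairwise (\<lambda>x y. \<not> [x = y] (mod int n)) A"
  shows "weight (word n A) = card A"
proof -
  have "{i. i < length (word n A) \<and> word n A ! i} = (\<lambda>x. nat (x mod int n)) ` A"
    using assms(1) by (force simp: nth_word cong_int_iff_nat_mod nat_less_iff)
  moreover have "inj_on (\<lambda>x. nat (x mod int n)) A"
    using assms by (auto simp: inj_on_def pairwise_def cong_def eq_nat_nat_iff)
  ultimately show ?thesis
    by (simp add: weight_def card_image)
qed

lemma word_eqD:
  assumes "word n A = word n B" "0 < n" "x \<in> A"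
  shows "\<exists>y\<in>B. [x = y] (mod int n)"
proof -
  let ?i = "nat (x mod int n)"
  have i: "?i < n" using assms(2) by (simp add: nat_less_iff)
  have "[x = int ?i] (mod int n)" using i by (simp only: cong_int_iff_nat_mod)
  then show ?thesis
    using nth_word[OF i, of A] nth_word[OF i, of B] assms by (metis cong_sym cong_trans)
qed

lemma word_cong:
  assumes "\<And>x. x \<in> A \<Longrightarrow> \<exists>y\<in>B. [x = y] (mod int n)" "\<And>y. y \<in> B \<Longrightarrow> \<exists>x\<in>A. [y = x] (mod int n)"
  shows "word n A = word n B"
  unfolding word_def using assms by (auto) (meson cong_sym cong_trans)+

text \<open>No element of \<open>A\<close> shares the residue of \<open>x\<close>, so clearing that
  entry removes only the moved particle; setting the next entry puts it back one step
  further.\<close>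

lemma word_step:
  assumes "2 \<le> n" "\<And>a. a \<in> A \<Longrightarrow> \<not> [a = x] (mod int n)"
  shows "\<exists>j<n. word n (insert (x + 1) A) = \<tau> j (word n (insert x A))"
proof (intro exI conjI)
  let ?j = "nat (x mod int n)"
  show j: "?j < n" using assms(1) by (simp add: nat_less_iff)
  have j': "(?j + 1) mod n = nat ((x + 1) mod int n)"
  proof -
    have "int ((?j + 1) mod n) = (x + 1) mod int n"
      using assms(1) by (simp add: zmod_int mod_add_left_eq mod_add_right_eq add.commute)
    then show ?thesis by linarith
  qed
  \<comment> \<open>As \<open>n\<close> is at least 2, the cleared and the set position differ, so
    the two updates do not interfere.\<close>
  have ne: "\<not> [x + 1 = x] (mod int n)"
    using assms(1) by (simp add: cong_iff_dvd_diff)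
  show "word n (insert (x + 1) A) = \<tau> ?j (word n (insert x A))"
  proof (rule nth_equalityI)
    fix i assume "i < length (word n (insert (x + 1) A))"
    then have i: "i < n" by simp
    have ins: "word n (insert y A) ! i \<longleftrightarrow> i = nat (y mod int n) \<or> word n A ! i" for y
      using i by (simp add: nth_word cong_int_iff_nat_mod)
    have A: "\<not> word n A ! i" if "i = ?j"
      using that assms(2) nth_word[OF i, of A] cong_int_iff_nat_mod[OF i, of x]
      by (meson cong_sym cong_trans)
    have X: "nat ((x + 1) mod int n) \<noteq> ?j"
      using ne assms(1) by (simp add: cong_def eq_nat_nat_iff)
    have "\<tau> ?j (word n (insert x A)) ! i \<longleftrightarrow>
        i = nat ((x + 1) mod int n) \<or> i \<noteq> ?j \<and> word n (insert x A) ! i"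
      using i j by (auto simp: \<tau>_def nth_list_update simp flip: j')
    then show "word n (insert (x + 1) A) ! i = \<tau> ?j (word n (insert x A)) ! i"
      using A X by (auto simp: ins)
  qed (simp add: \<tau>_def)
qed

section \<open>States and their transitions\<close>

text \<open>\<open>q\<close> counts the completed rounds, each a translation by \<open>- k\<close>,
  and \<open>r\<close> the moves of the leading particle in the current round; \<open>b\<close> is
  the middle particle.\<close>

definition state :: "nat \<Rightarrow> nat \<Rightarrow> nat \<Rightarrow> nat \<Rightarrow> bool list" where
  "state n k q r = (let b = - (int q * int k) in word n {b + int k + int r, b, b - int k})"

lemma not_cong_of_diff_less:
  fixes x y m :: int
  assumes "x < y" "y < x + m"
  shows "\<not> [x = y] (mod m)" "\<not> [y = x] (mod m)"
  using assms zdvd_imp_le[of m "y - x"] by (auto simp: cong_iff_dvd_diff dvd_diff_commute)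

lemma state_in_const_weight_strings:
  assumes "0 < k" "3 * k + r < n"
  shows "state n k q r \<in> const_weight_strings n 3"
proof -
  define b where "b = - (int q * int k)"
  have "weight (word n {b + int k + int r, b, b - int k}) = card {b + int k + int r, b, b - int k}"
    \<comment> \<open>The three integers span \<open>2 * k + r\<close>, less than \<open>n\<close>,
      so they are pairwise incongruent.\<close>
    using assms by (intro weight_word) (auto simp: pairwise_insert not_cong_of_diff_less)
  also have "\<dots> = 3" using assms by simp
  finally show ?thesis
    by (simp add: state_def const_weight_strings_def Let_def flip: b_def)
qed

definition gray_step :: "nat \<Rightarrow> bool list \<Rightarrow> bool list \<Rightarrow> bool" where
  "gray_step n v v' \<longleftrightarrow> (\<exists>j<n. v' = \<tau> j v)"

text \<open>The bound concerns the source only: from the largest admissible \<open>r\<close> the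
  move reaches \<open>n - 3 * k\<close>, which is the start of the next round.\<close>

lemma gray_step_Suc_r:
  assumes "0 < k" "3 * k + r < n"
  shows "gray_step n (state n k q r) (state n k q (Suc r))"
proof -
  define b where "b = - (int q * int k)"
  have "\<exists>j<n. word n (insert (b + int k + int r + 1) {b, b - int k})
      = \<tau> j (word n (insert (b + int k + int r) {b, b - int k}))"
    using assms by (intro word_step) (auto simp: not_cong_of_diff_less)
  then show ?thesis
    by (simp add: gray_step_def state_def Let_def add_ac flip: b_def)
qed

text \<open>The leading particle has come around to \<open>b - 2 * k\<close>, a distance
  \<open>k\<close> behind the rear one. The roles rotate: the rear particle becomes the middle one,
  the middle one the leader.\<close>

lemma state_end_of_round:
  assumes "3 * k \<le> n"
  shows "state n k q (n - 3 * k) = state n k (Suc q) 0"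
proof -
  define b where "b = - (int q * int k)"
  have "[b + int k + int (n - 3 * k) = b - int k - int k] (mod int n)"
    using assms by (simp add: cong_iff_dvd_diff of_nat_diff)
  then have "word n {b + int k + int (n - 3 * k), b, b - int k} = word n {b, b - int k, b - int k - int k}"
    by (intro word_cong) (auto intro: cong_sym)
  moreover have "- (int (Suc q) * int k) = b - int k"
    by (simp add: b_def algebra_simps)
  ultimately show ?thesis
    by (simp add: state_def Let_def flip: b_def)
qed

lemma gray_step_Suc_q:
  assumes "0 < k" "3 * k < n"
  shows "gray_step n (state n k q (n - 3 * k - 1)) (state n k (Suc q) 0)"
  using gray_step_Suc_r[of k "n - 3 * k - 1" n q] state_end_of_round[of k n q] assms
  by (simp add: Suc_diff_Suc)

text \<open>In the last round \<open>b\<close> is congruent to \<open>k\<close>, so the final state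
  occupies \<open>k\<close>, \<open>0\<close> and \<open>- 1 - k\<close>. Moving the middle particle
  from \<open>k\<close> to \<open>k + 1\<close>, instead of the leader, gives the symmetric triple
  around 0 with gap \<open>Suc k\<close>.\<close>

lemma gray_step_Suc_k:
  assumes "0 < k" "3 * Suc k < n"
  shows "gray_step n (state n k (n - 1) (n - 3 * k - 1)) (state n (Suc k) 0 0)"
proof -
  define b where "b = - (int (n - 1) * int k)"
  have b: "[b = int k] (mod int n)"
    using assms by (simp add: b_def cong_iff_dvd_diff of_nat_diff algebra_simps)
  have b0: "[b - int k = 0] (mod int n)"
    using cong_diff[OF b cong_refl[of "int k"]] by simp
  \<comment> \<open>The right-hand side equals \<open>- 1 - k\<close>; the \<open>n\<close>
    subtracted on the left does not affect the residue and is dropped next.\<close>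
  have "[b + int k + int (n - 3 * k - 1) - int n = int k + int k + int (n - 3 * k - 1) - int n] (mod int n)"
    by (intro cong_add cong_diff b cong_refl)
  then have b1: "[b + int k + int (n - 3 * k - 1) = - 1 - int k] (mod int n)"
    using assms dvd_add_right_iff[of "int n" "int n" "b - int k"]
    by (simp add: of_nat_diff cong_iff_dvd_diff algebra_simps)
  have "word n {b + int k + int (n - 3 * k - 1), b, b - int k} = word n (insert (int k) {0, - 1 - int k})"
    using b b0 b1 by (intro word_cong) (auto intro: cong_sym)
  moreover have "\<exists>j<n. word n (insert (int k + 1) {0, - 1 - int k}) = \<tau> j (word n (insert (int k) {0, - 1 - int k}))"
    using assms by (intro word_step) (auto simp: not_cong_of_diff_less)
  moreover have "state n k (n - 1) (n - 3 * k - 1) = word n {b + int k + int (n - 3 * k - 1), b, b - int k}"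
    by (simp only: state_def Let_def b_def)
  moreover have "state n (Suc k) 0 0 = word n (insert (int k + 1) {0, - 1 - int k})"
    by (simp add: state_def algebra_simps)
  ultimately show ?thesis
    by (simp only: gray_step_def)
qed

section \<open>Distinct parameters give distinct states\<close>

text \<open>Replaces a congruence between gaps by three equations accessible to linear
  arithmetic.\<close>

lemma dvd_small_cases:
  fixes m z :: int
  assumes "m dvd z" "\<bar>z\<bar> < 2 * m"
  shows "z = - m \<or> z = 0 \<or> z = m"
proof -
  from assms(1) obtain t where t: "z = m * t" ..
  have m: "0 < m" using assms(2) by linarith
  have "\<bar>t\<bar> * m < 2 * m" using assms(2) m by (simp add: t abs_mult mult.commute)
  then have "\<bar>t\<bar> < 2" using m by simp
  then have "t = -1 \<or> t = 0 \<or> t = 1" by linarith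
  then show ?thesis by (auto simp: t)
qed

text \<open>The cyclic sequence of gaps is \<open>k, k + r, m - 2k - r\<close>, and the unique place where a gap of
  minimal size follows a strictly larger one determines \<open>k\<close>, \<open>r\<close> and the middle element.\<close>

lemma gaps_unique:
  fixes b b' k k' r r' m :: int
  assumes "0 < k" "0 \<le> r" "3 * k + r < m" "0 < k'" "0 \<le> r'" "3 * k' + r' < m"
    and "\<exists>x\<in>{b + k + r, b, b - k}. [b' + k' + r' = x] (mod m)"
    and "\<exists>x\<in>{b + k + r, b, b - k}. [b' = x] (mod m)"
    and "\<exists>x\<in>{b + k + r, b, b - k}. [b' - k' = x] (mod m)"
  shows "k = k' \<and> r = r' \<and> [b' = b] (mod m)"
proof -
  \<comment> \<open>Offsets from \<open>b\<close>: only differences of positions matter for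
    \<open>k\<close> and \<open>r\<close>.\<close>
  define D where "D = {k + r, 0, - k}"
  have shift: "\<exists>x\<in>D. [t = b + x] (mod m)" if "\<exists>x\<in>{b + k + r, b, b - k}. [t = x] (mod m)" for t
    using that by (auto simp: D_def add.assoc)
  obtain x y z where D: "x \<in> D" "y \<in> D" "z \<in> D"
    and c: "[b' + k' + r' = b + x] (mod m)" "[b' = b + y] (mod m)" "[b' - k' = b + z] (mod m)"
    using assms(7-9)[THEN shift] by blast
  have "m dvd y - z - k'"
    using cong_diff[OF c(2,3)] by (simp add: cong_iff_dvd_diff dvd_diff_commute algebra_simps)
  \<comment> \<open>Two offsets differ by at most \<open>2 * k + r\<close>, and both this and
    \<open>k'\<close> are below \<open>m\<close>.\<close>
  moreover have "\<bar>y - z - k'\<bar> < 2 * m" using D assms(1-6) by (auto simp: D_def)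
  ultimately have 1: "y - z - k' = - m \<or> y - z - k' = 0 \<or> y - z - k' = m"
    by (rule dvd_small_cases)
  have "m dvd x - y - k' - r'"
    using cong_diff[OF c(1,2)] by (simp add: cong_iff_dvd_diff dvd_diff_commute algebra_simps)
  moreover have "\<bar>x - y - k' - r'\<bar> < 2 * m" using D assms(1-6) by (auto simp: D_def)
  ultimately have 2: "x - y - k' - r' = - m \<or> x - y - k' - r' = 0 \<or> x - y - k' - r' = m"
    by (rule dvd_small_cases)
  \<comment> \<open>Each choice of \<open>x\<close>, \<open>y\<close>, \<open>z\<close> in
    \<open>D\<close> and of the two multiples of \<open>m\<close> gives a linear system; the gap
    bounds refute every one in which the conclusion fails.\<close>
  have "k = k' \<and> r = r' \<and> y = 0"
    using D 1 2 assms(1-6) unfolding D_def by (elim insertE emptyE disjE) (simp_all; linarith)+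
  then show ?thesis using c(2) by simp
qed

text \<open>Comparing gaps yields \<open>k\<close> and \<open>r\<close>. Since \<open>n\<close> is
  prime and \<open>0 < k < n\<close>, \<open>k\<close> is invertible modulo \<open>n\<close>, so the
  middle position \<open>- q * k\<close> determines \<open>q\<close>.\<close>

lemma state_inj:
  assumes "prime n" "state n k q r = state n k' q' r'"
    and "0 < k" "3 * k + r < n" "q < n" "0 < k'" "3 * k' + r' < n" "q' < n"
  shows "k = k' \<and> q = q' \<and> r = r'"
proof -
  define b where "b = - (int q * int k)"
  define b' where "b' = - (int q' * int k')"
  have *: "word n {b' + int k' + int r', b', b' - int k'} = word n {b + int k + int r, b, b - int k}"
    using assms(2) by (simp add: state_def Let_def flip: b_def b'_def)
  have "int k = int k' \<and> int r = int r' \<and> [b' = b] (mod int n)"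
    using assms(3-) by (intro gaps_unique word_eqD[OF *]) auto
  then have kr: "k = k'" "r = r'" and "[int (q' * k) = int (q * k)] (mod int n)"
    by (auto simp: b_def b'_def cong_minus_minus_iff)
  then have "[q' * k = q * k] (mod n)"
    by (simp only: cong_int_iff)
  moreover have "coprime k n"
    using assms(1,3,4) prime_imp_coprime[of n k] nat_dvd_not_less[of k n] by (simp add: coprime_commute)
  ultimately have "[q' = q] (mod n)"
    by (simp add: cong_mult_rcancel_nat)
  then have "q' = q"
    using assms by (intro cong_less_modulus_unique_nat)
  then show ?thesis
    using kr by simp
qed

section \<open>Concatenating the rounds\<close>

text \<open>Nonempty blocks make \<open>last\<close> and \<open>hd\<close> meaningful at the joints
  and ensure that consecutive blocks really touch.\<close>

lemma successively_concat:
  assumes "\<And>xs. xs \<in> set xss \<Longrightarrow> xs \<noteq> []" "\<And>xs. xs \<in> set xss \<Longrightarrow> successively P xs"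
    and "successively (\<lambda>xs ys. P (last xs) (hd ys)) xss"
  shows "successively P (concat xss)"
  using assms
proof (induction xss)
  case (Cons xs xss)
  show ?case
  proof (cases xss)
    case (Cons ys yss)
    then show ?thesis
      using Cons.IH Cons.prems by (auto simp: successively_append_iff)
  qed (use Cons.prems in simp)
qed simp

lemma successively_upt:
  "(\<And>i. a \<le> i \<Longrightarrow> Suc i < b \<Longrightarrow> P i (Suc i)) \<Longrightarrow> successively P [a..<b]"
  by (simp add: successively_conv_nth)

lemma distinct_concat_map:
  assumes "distinct xs" "\<And>x. x \<in> set xs \<Longrightarrow> distinct (f x)"
    and "\<And>x y. x \<in> set xs \<Longrightarrow> y \<in> set xs \<Longrightarrow> x \<noteq> y \<Longrightarrow> set (f x) \<inter> set (f y) = {}"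
  shows "distinct (concat (map f xs))"
  using assms
proof (induction xs)
  case (Cons a xs)
  have "distinct (concat (map f xs))"
    using Cons.prems by (intro Cons.IH) auto
  moreover have "set (f a) \<inter> set (f x) = {}" if "x \<in> set xs" for x
    using that Cons.prems(1) by (intro Cons.prems(3)) auto
  ultimately show ?case
    using Cons.prems(2) by auto
qed simp

definition round_code :: "nat \<Rightarrow> nat \<Rightarrow> nat \<Rightarrow> bool list list" where
  "round_code n k q = map (state n k q) [0..<n - 3 * k]"

definition gap_code :: "nat \<Rightarrow> nat \<Rightarrow> bool list list" where
  "gap_code n k = concat (map (round_code n k) [0..<n])"

text \<open>The range of \<open>k\<close> consists of exactly the positive values with
  \<open>3 * k < n\<close>, those for which a round is nonempty.\<close>

definition full_code :: "nat \<Rightarrow> bool list list" where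
  "full_code n = concat (map (gap_code n) [1..<Suc ((n - 1) div 3)])"

lemma set_round_code: "set (round_code n k q) = {state n k q r | r. 3 * k + r < n}"
  by (auto simp: round_code_def)

lemma set_gap_code: "set (gap_code n k) = {state n k q r | q r. q < n \<and> 3 * k + r < n}"
  by (fastforce simp: gap_code_def set_round_code)

lemma set_full_code:
  "set (full_code n) = {state n k q r | k q r. 0 < k \<and> q < n \<and> 3 * k + r < n}"
proof -
  have "set [1..<Suc ((n - 1) div 3)] = {k. 0 < k \<and> 3 * k < n}"
    by (auto simp: Suc_le_eq)
  then show ?thesis by (fastforce simp: full_code_def set_gap_code)
qed

lemma hd_last_round_code:
  assumes "3 * k < n"
  shows "round_code n k q \<noteq> []" "hd (round_code n k q) = state n k q 0"
    "last (round_code n k q) = state n k q (n - 3 * k - 1)"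
  using assms by (auto simp: round_code_def hd_map last_map)

lemma hd_last_gap_code:
  assumes "3 * k < n"
  shows "gap_code n k \<noteq> []" "hd (gap_code n k) = state n k 0 0"
    "last (gap_code n k) = state n k (n - 1) (n - 3 * k - 1)"
proof -
  \<comment> \<open>The first round is split off to compute \<open>hd\<close>, and below the last
    one to compute \<open>last\<close>.\<close>
  have "[0..<n] = 0 # [1..<n]"
    using assms by (simp add: upt_conv_Cons)
  then have "gap_code n k = round_code n k 0 @ concat (map (round_code n k) [1..<n])"
    by (simp add: gap_code_def del: upt_Suc)
  moreover have "[0..<n] = [0..<n - 1] @ [n - 1]"
    using assms upt_Suc_append[of 0 "n - 1"] by simp
  then have "gap_code n k = concat (map (round_code n k) [0..<n - 1]) @ round_code n k (n - 1)"
    by (simp add: gap_code_def del: upt_Suc)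
  ultimately
  show "gap_code n k \<noteq> []" "hd (gap_code n k) = state n k 0 0"
    "last (gap_code n k) = state n k (n - 1) (n - 3 * k - 1)"
    using hd_last_round_code[OF assms] by (metis append_is_Nil_conv, metis hd_append2, metis last_appendR)
qed

lemma successively_gap_code:
  assumes "0 < k" "3 * k < n"
  shows "successively (gray_step n) (gap_code n k)"
  unfolding gap_code_def
proof (rule successively_concat)
  fix xs assume "xs \<in> set (map (round_code n k) [0..<n])"
  then show "successively (gray_step n) xs"
    using assms by (auto simp: round_code_def successively_map intro!: successively_upt gray_step_Suc_r)
next
  show "successively (\<lambda>xs ys. gray_step n (last xs) (hd ys)) (map (round_code n k) [0..<n])"
    using assms gray_step_Suc_q[OF assms]
    by (auto simp: hd_last_round_code successively_map intro!: successively_upt)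
qed (use hd_last_round_code(1)[OF assms(2)] in auto)

lemma successively_full_code: "successively (gray_step n) (full_code n)"
  unfolding full_code_def
proof (rule successively_concat)
  show "successively (\<lambda>xs ys. gray_step n (last xs) (hd ys))
      (map (gap_code n) [1..<Suc ((n - 1) div 3)])"
    unfolding successively_map
  proof (rule successively_upt)
    fix k assume "1 \<le> k" "Suc k < Suc ((n - 1) div 3)"
    then have "0 < k" "3 * Suc k < n" by auto
    then show "gray_step n (last (gap_code n k)) (hd (gap_code n (Suc k)))"
      using gray_step_Suc_k by (simp add: hd_last_gap_code)
  qed
next
  fix xs assume "xs \<in> set (map (gap_code n) [1..<Suc ((n - 1) div 3)])"
  then show "successively (gray_step n) xs"
    by (auto intro!: successively_gap_code)
next
  fix xs assume "xs \<in> set (map (gap_code n) [1..<Suc ((n - 1) div 3)])"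
  then show "xs \<noteq> []"
    by (auto simp: hd_last_gap_code(1))
qed

lemma distinct_full_code:
  assumes "prime n"
  shows "distinct (full_code n)"
  unfolding full_code_def
proof (rule distinct_concat_map)
  fix k assume "k \<in> set [1..<Suc ((n - 1) div 3)]"
  then have k: "0 < k" by auto
  show "distinct (gap_code n k)"
    unfolding gap_code_def
  proof (rule distinct_concat_map)
    fix q assume "q \<in> set [0..<n]"
    then show "distinct (round_code n k q)"
      using k state_inj[OF assms] by (auto simp: round_code_def distinct_map inj_on_def)
  next
    fix q q' assume "q \<in> set [0..<n]" "q' \<in> set [0..<n]" "q \<noteq> q'"
    then show "set (round_code n k q) \<inter> set (round_code n k q') = {}"
      using k state_inj[OF assms] by (fastforce simp: set_round_code)
  qed simp
next
  fix k k' assume "k \<in> set [1..<Suc ((n - 1) div 3)]" "k' \<in> set [1..<Suc ((n - 1) div 3)]" "k \<noteq> k'"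
  then show "set (gap_code n k) \<inter> set (gap_code n k') = {}"
    using state_inj[OF assms] by (fastforce simp: set_gap_code)
qed simp

section \<open>Length and efficiency\<close>

text \<open>Gap \<open>k\<close> contributes \<open>n\<close> rounds of \<open>n - 3 * k\<close>
  words. If 3 divided \<open>n\<close>, the \<open>n / 3\<close> equally spaced triples would be
  missing from the count.\<close>

lemma length_full_code:
  assumes "\<not> 3 dvd n"
  shows "length (full_code n) = n choose 3"
proof -
  define K where "K = (n - 1) div 3"
  have n: "n = 3 * K + 1 \<or> n = 3 * K + 2"
    using assms unfolding K_def by presburger
  have "length (full_code n) = (\<Sum>k=1..K. n * (n - 3 * k))"
    by (simp add: full_code_def gap_code_def round_code_def length_concat comp_def sum_list_triv
        interv_sum_list_conv_sum_set_nat atLeastLessThanSuc_atLeastAtMost K_def del: upt_Suc)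
  also have "real \<dots> = (\<Sum>k=1..K. real n * (real n - 3 * real k))"
    unfolding of_nat_sum using n by (intro sum.cong) (auto simp: of_nat_diff)
  also have "\<dots> = real n * (real n * real K - 3 * (real K * (real K + 1) / 2))"
    by (induction K) (simp_all add: field_simps)
  \<comment> \<open>\<open>3 * (K + 1)\<close> is \<open>n + 2\<close> or \<open>n + 1\<close>, and
    both cases lead to the same polynomial in \<open>n\<close>.\<close>
  also have "\<dots> = real n * (real n - 1) * (real n - 2) / 6"
    using n by (auto simp: field_simps)
  also have "\<dots> = real (n choose 3)"
    by (simp add: binomial_gbinomial gbinomial_prod_rev eval_nat_numeral prod.atLeast0_lessThan_Suc)
  finally show ?thesis by (simp only: of_nat_eq_iff)
qed

lemma const_weight_gray_code_full_code:
  assumes "prime n" "5 \<le> n"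
  shows "const_weight_gray_code n 3 (full_code n)"
  using assms successively_full_code[of n] distinct_full_code[of n] state_in_const_weight_strings
  by (auto simp: const_weight_gray_code_def set_full_code successively_conv_nth gray_step_def)

lemma efficiency_full_code:
  assumes "prime n" "5 \<le> n"
  shows "efficiency n 3 (full_code n) = 1"
proof -
  have "\<not> 3 dvd n"
    using assms by (auto simp: prime_nat_iff)
  then show ?thesis
    using assms(2) by (simp add: efficiency_def length_full_code)
qed

theorem corollary18:
  "\<exists>(n :: nat \<Rightarrow> nat) (G :: nat \<Rightarrow> bool list list).
     strict_mono n \<and> (\<forall>i. 0 < n i) \<and>
     (\<forall>i. const_weight_gray_code (n i) 3 (G i)) \<and>
     (\<lambda>i. efficiency (n i) 3 (G i)) \<longlonglongrightarrow> 1"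
proof -
  \<comment> \<open>The bound discards the primes 2 and 3, for which weight 3 exceeds
    \<open>n - 1\<close>.\<close>
  define P where "P = {p :: nat. prime p \<and> 5 \<le> p}"
  have "infinite P"
    using bigger_prime by (auto simp: P_def infinite_nat_iff_unbounded_le)
      (meson le_trans less_imp_le max.bounded_iff)
  then have mono: "strict_mono (enumerate P)" and P: "enumerate P i \<in> P" for i
    by (simp_all add: strict_mono_enumerate enumerate_in_set)
  show ?thesis
    \<comment> \<open>With these primes in increasing order as lengths, the efficiencies are
      constantly 1.\<close>
    using mono P
    by (intro exI[of _ "enumerate P"] exI[of _ "\<lambda>i. full_code (enumerate P i)"])
      (auto simp: P_def const_weight_gray_code_full_code efficiency_full_code prime_gt_0_nat)
qed

end
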